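(* As $N$ tends to infinity through the superabundant numbers, $$\lim_{N\to\infty}\frac{d^{(1)}(N)}{\log N}=e^{-\gamma}.$$
   Context: A positive integer $N$ is superabundant if $\sigma(M)/M<\sigma(N)/N$ for all positive integers $M<N$, where $\sigma$ is the sum-of-divisors function. For a (sufficiently large) positive integer $N$, enumerate its divisors as $1=d_1<d_2<\cdots<d_{\tau(N)}=N$. The first cutoff divisor is $$d^{(1)}(N):=\max\left\{d_j:\ \sum_{i=1}^j\frac{N}{d_i}\le N\log\log N\right\}.$$ $\gamma$ is the Euler–Mascheroni constant. *)

theory Defs
  imports "HOL-Analysis.Harmonic_Numbers"
begin

definition sigma :: "nat \<Rightarrow> nat" where
  "sigma n = (\<Sum>d | d dvd n. d)"

definition superabundant :: "nat \<Rightarrow> bool" where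
  "superabundant N \<longleftrightarrow> N > 0 \<and>
     (\<forall>M. 0 < M \<and> M < N \<longrightarrow> real (sigma M) / real M < real (sigma N) / real N)"

(* Increasing enumeration of the divisors of N > 0, indexed from 0:
   divisors_list N ! i is the divisor usually written d_(i+1). *)
definition divisors_list :: "nat \<Rightarrow> nat list" where
  "divisors_list N = sorted_list_of_set {d. d dvd N}"

(* For small N the set below may be empty and the value of Max is then unspecified.
   For N > 15 we have ln (ln N) > 1, so the set contains the divisor 1. *)
definition first_cutoff :: "nat \<Rightarrow> nat" where
  "first_cutoff N = Max {divisors_list N ! j | j. j < length (divisors_list N) \<and>
     (\<Sum>i\<le>j. real N / real (divisors_list N ! i)) \<le> real N * ln (ln (real N))}"

end

theory Submission
  imports Defs "HOL-Computational_Algebra.Primes" "HOL-Real_Asymp.Real_Asymp"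
begin

text \<open>
  Let $p$ be the largest prime factor of a superabundant number $N$. Exchanging prime factors of
  $N$ shows that every integer up to $p - \sqrt p$ divides $N$, and that the prime factors of $N$
  with multiplicity greater than one contribute only $o(p)$ to $\ln N$, provided that there is a
  prime $s > p$ with $s \le p^{3/2}$. Hence $\ln N \le \vartheta(p) + o(p)$, and the elementary
  bound $\vartheta(p) \le p \ln 4$ replaces the prime number theorem: since
  $e^{-\gamma} < 1 / \ln 4$, all integers up to $c \ln N$ divide $N$ for some $c > e^{-\gamma}$.
  So the cutoff divisor is simply the largest $d$ whose harmonic number is at most $\ln \ln N$,
  and $H_d = \ln d + \gamma + o(1)$ gives the limit.
\<close>

section \<open>Abundancy of superabundant numbers\<close>

definition abundancy :: "nat \<Rightarrow> real" where
  "abundancy n = real (sigma n) / real n"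

lemma abundancy_alt:
  assumes "n > 0"
  shows "abundancy n = (\<Sum>d | d dvd n. 1 / real d)"
proof -
  have "(\<Sum>d | d dvd n. 1 / real d) = (\<Sum>d | d dvd n. real d / real n)"
    using assms
    by (intro sum.reindex_bij_witness[of _ "\<lambda>d. n div d" "\<lambda>d. n div d"])
       (auto elim!: dvdE simp: field_simps)
  thus ?thesis
    by (simp add: abundancy_def sigma_def sum_divide_distrib)
qed

lemma abundancy_pos: "n > 0 \<Longrightarrow> abundancy n > 0"
  unfolding abundancy_alt by (rule sum_pos) auto

text \<open>Each divisor of \<open>a * b\<close> is uniquely a divisor of \<open>a\<close> times a
  divisor of \<open>b\<close>, so the sum of reciprocals factors.\<close>

lemma abundancy_mult_coprime:
  assumes "coprime a b" "a > 0" "b > 0"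
  shows "abundancy (a * b) = abundancy a * abundancy b"
proof -
  have inj: "inj_on (\<lambda>(x, y). x * y) ({d. d dvd a} \<times> {d. d dvd b})"
  proof (rule inj_onI, clarify)
    fix x y x' y'
    assume *: "x dvd a" "y dvd b" "x' dvd a" "y' dvd b" "x * y = x' * y'"
    have "coprime x y'" "coprime x' y"
      using * assms(1) by (meson coprime_divisors)+
    hence "x dvd x'" "x' dvd x"
      using *(5) by (metis coprime_dvd_mult_left_iff dvd_triv_left)+
    hence "x = x'" by (rule dvd_antisym)
    moreover have "x > 0" using \<open>x dvd a\<close> assms(2) by (auto intro: Nat.gr0I)
    ultimately show "x = x' \<and> y = y'" using *(5) by auto
  qed
  have img: "{d. d dvd a * b} = (\<lambda>(x, y). x * y) ` ({d. d dvd a} \<times> {d. d dvd b})"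
  proof safe
    fix d assume "d dvd a * b"
    then obtain x y where "d = x * y" "x dvd a" "y dvd b"
      by (rule division_decomp[THEN exE]) blast
    thus "d \<in> (\<lambda>(x, y). x * y) ` ({d. d dvd a} \<times> {d. d dvd b})" by auto
  qed (auto intro: mult_dvd_mono)
  have "(\<Sum>d | d dvd a * b. 1 / real d) =
      (\<Sum>(x, y)\<in>{d. d dvd a} \<times> {d. d dvd b}. (1 / real x) * (1 / real y))"
    unfolding img by (subst sum.reindex[OF inj]) (simp add: o_def case_prod_unfold)
  thus ?thesis
    using assms by (simp add: abundancy_alt sum_product sum.cartesian_product)
qed

text \<open>The argument \<open>a\<close> counts terms: \<open>geo q (Suc a)\<close> is the
  abundancy of \<open>q ^ a\<close>, while \<open>geo q i\<close> measures the effect of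
  \<open>i\<close> further factors \<open>q\<close>.\<close>

definition geo :: "nat \<Rightarrow> nat \<Rightarrow> real" where
  "geo q a = (\<Sum>i<a. (1 / real q) ^ i)"

lemma abundancy_prime_power:
  assumes "prime q"
  shows "abundancy (q ^ a) = geo q (Suc a)"
proof -
  have "{d. d dvd q ^ a} = (\<lambda>i. q ^ i) ` {..<Suc a}"
    using assms by (auto simp: divides_primepow_nat less_Suc_eq_le)
  moreover have "inj_on (\<lambda>i. q ^ i) {..<Suc a}"
    using prime_gt_1_nat[OF assms] by (auto intro!: inj_onI)
  ultimately show ?thesis
    using prime_gt_0_nat[OF assms]
    by (simp add: abundancy_alt geo_def sum.reindex power_one_over del: sum.lessThan_Suc)
qed

text \<open>Isolates the \<open>q\<close>-part of \<open>n\<close>; as \<open>m\<close> is the same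
  for all \<open>k\<close>, changing the exponent of \<open>q\<close> changes only one
  \<open>geo\<close> factor.\<close>

lemma abundancy_decompose:
  assumes "prime q" "n > 0"
  obtains m where "m > 0" "n = m * q ^ multiplicity q n" "\<not> q dvd m"
    "\<And>k. abundancy (m * q ^ k) = abundancy m * geo q (Suc k)"
proof -
  obtain m where m: "n = q ^ multiplicity q n * m" "\<not> q dvd m"
    using multiplicity_decompose'[of n q] assms by (metis not_prime_unit not_gr_zero)
  have "m > 0" using m(1) assms(2) by (cases m) auto
  have "abundancy (m * q ^ k) = abundancy m * geo q (Suc k)" for k
  proof -
    have "coprime m (q ^ k)"
      using m(2) assms(1) by (metis coprime_commute coprime_power_left_iff prime_imp_coprime)
    thus ?thesis using \<open>m > 0\<close> assms
      by (simp add: abundancy_mult_coprime abundancy_prime_power prime_gt_0_nat)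
  qed
  thus ?thesis using that[of m] m \<open>m > 0\<close> by (simp add: mult.commute)
qed

lemma geo_bounds:
  assumes "q \<ge> 2"
  shows "geo q (Suc a) \<ge> 1" "geo q a \<le> 2"
    "geo q a = (1 - (1 / real q) ^ a) * (real q / (real q - 1))"
    "geo q a \<le> real q / (real q - 1)"
proof -
  show "geo q (Suc a) \<ge> 1"
    unfolding geo_def sum.lessThan_Suc_shift by (simp add: sum_nonneg)
  show *: "geo q a = (1 - (1 / real q) ^ a) * (real q / (real q - 1))"
  proof -
    have "geo q a = (1 - (1 / real q) ^ a) / (1 - 1 / real q)"
      using assms by (simp add: geo_def sum_gp_strict del: power_one_over)
    also have "\<dots> = (1 - (1 / real q) ^ a) * (1 / (1 - 1 / real q))" by simp
    also have "1 / (1 - 1 / real q) = real q / (real q - 1)" using assms by (simp add: field_simps)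
    finally show ?thesis .
  qed
  have "(1 - (1 / real q) ^ a) * (real q / (real q - 1)) \<le> 1 * (real q / (real q - 1))"
    using assms by (intro mult_right_mono) auto
  thus le: "geo q a \<le> real q / (real q - 1)" using * by simp
  have "real q / (real q - 1) \<le> 2" using assms by (simp add: field_simps)
  thus "geo q a \<le> 2" using le by linarith
qed

lemma geo_add: "geo q (a + i) = geo q a + (1 / real q) ^ a * geo q i"
proof (induction i)
  case (Suc i)
  have "geo q (a + Suc i) = geo q (a + i) + (1 / real q) ^ (a + i)" by (simp add: geo_def)
  also have "\<dots> = geo q a + (1 / real q) ^ a * (geo q i + (1 / real q) ^ i)"
    using Suc.IH by (simp add: power_add algebra_simps)
  finally show ?case by (simp add: geo_def)
qed (simp add: geo_def)

text \<open>With \<open>a\<close> the multiplicity of \<open>q\<close> in \<open>n\<close>, the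
  local factor \<open>geo q (Suc a)\<close> grows by \<open>geo q i / q ^ Suc a\<close>. That factor
  is at least 1, so the relative growth is no larger.\<close>

lemma abundancy_mult_prime_power_le:
  assumes "prime q" "n > 0"
  shows "abundancy (n * q ^ i) \<le> abundancy n * (1 + geo q i / real (q ^ Suc (multiplicity q n)))"
proof -
  define a where "a = multiplicity q n"
  obtain m where m: "m > 0" "n = m * q ^ a"
    "\<And>k. abundancy (m * q ^ k) = abundancy m * geo q (Suc k)"
    using abundancy_decompose[OF assms] unfolding a_def by metis
  have q: "q \<ge> 2" using assms(1) by (rule prime_ge_2_nat)
  have g: "geo q i \<ge> 0" by (simp add: geo_def sum_nonneg)
  have "n * q ^ i = m * q ^ (a + i)" by (simp add: m(2) power_add)
  hence "abundancy (n * q ^ i) = abundancy m * geo q (Suc a + i)" by (simp add: m(3))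
  also have "\<dots> = abundancy m * (geo q (Suc a) + geo q i / real (q ^ Suc a))"
    by (subst geo_add) (simp add: power_one_over field_simps)
  also have "\<dots> \<le> abundancy m * (geo q (Suc a) + geo q (Suc a) * (geo q i / real (q ^ Suc a)))"
  proof -
    have "1 * (geo q i / real (q ^ Suc a)) \<le> geo q (Suc a) * (geo q i / real (q ^ Suc a))"
      by (intro mult_right_mono geo_bounds q divide_nonneg_nonneg g) auto
    thus ?thesis using abundancy_pos[OF m(1)] by simp
  qed
  also have "\<dots> = abundancy m * geo q (Suc a) * (1 + geo q i / real (q ^ Suc a))"
    by (simp add: algebra_simps)
  also have "abundancy m * geo q (Suc a) = abundancy n" using m(3)[of a] m(2) by simp
  finally show ?thesis by (simp add: a_def)
qed

text \<open>The growth is again \<open>geo q i / q ^ Suc a\<close>, now relative to a local factor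
  of at most \<open>q / (q - 1)\<close>; the closed form of \<open>geo q i\<close> contains the same
  quotient, which cancels.\<close>

lemma abundancy_mult_prime_power_ge:
  assumes "prime q" "n > 0"
  shows "abundancy (n * q ^ i) \<ge>
    abundancy n * (1 + (1 - 1 / real (q ^ i)) / real (q ^ Suc (multiplicity q n)))"
proof -
  define a where "a = multiplicity q n"
  obtain m where m: "m > 0" "n = m * q ^ a"
    "\<And>k. abundancy (m * q ^ k) = abundancy m * geo q (Suc k)"
    using abundancy_decompose[OF assms] unfolding a_def by metis
  have q: "q \<ge> 2" using assms(1) by (rule prime_ge_2_nat)
  have le: "geo q (Suc a) * (1 - 1 / real (q ^ i)) \<le> geo q i"
  proof -
    have "geo q (Suc a) * (1 - 1 / real (q ^ i)) \<le> real q / (real q - 1) * (1 - 1 / real (q ^ i))"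
      using q by (intro mult_right_mono geo_bounds) auto
    also have "\<dots> = geo q i" by (subst geo_bounds(3)[OF q]) (simp add: power_one_over)
    finally show ?thesis .
  qed
  have "abundancy n = abundancy m * geo q (Suc a)" using m(3)[of a] m(2) by simp
  hence "abundancy n * (1 + (1 - 1 / real (q ^ i)) / real (q ^ Suc a)) =
      abundancy m * (geo q (Suc a) + geo q (Suc a) * (1 - 1 / real (q ^ i)) / real (q ^ Suc a))"
    by (simp add: algebra_simps)
  also have "\<dots> \<le> abundancy m * (geo q (Suc a) + geo q i / real (q ^ Suc a))"
    using abundancy_pos[OF m(1)] le by (intro mult_left_mono add_left_mono divide_right_mono) auto
  also have "\<dots> = abundancy m * geo q (Suc a + i)"
    by (subst geo_add) (simp add: power_one_over field_simps)
  also have "\<dots> = abundancy (m * q ^ (a + i))" by (simp add: m(3))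
  also have "m * q ^ (a + i) = n * q ^ i" by (simp add: m(2) power_add)
  finally show ?thesis by (simp add: a_def)
qed

lemma abundancy_mult_new_prime:
  assumes "prime s" "\<not> s dvd n" "n > 0"
  shows "abundancy (n * s) = abundancy n * (1 + 1 / real s)"
proof -
  have "abundancy s = 1 + 1 / real s"
    using abundancy_prime_power[OF assms(1), of 1] by (simp add: geo_def)
  thus ?thesis
    using assms abundancy_mult_coprime[of n s]
    by (simp add: prime_gt_0_nat prime_imp_coprime coprime_commute[of n s])
qed

section \<open>Exchange arguments for superabundant numbers\<close>

lemma superabundant_less:
  assumes "superabundant N" "0 < M" "M < N"
  shows "abundancy M < abundancy N"
  using assms by (auto simp: superabundant_def abundancy_def)

lemma exists_power_between:
  fixes q x :: nat
  assumes "q \<ge> 2" "x > 0"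
  obtains i where "q ^ i \<le> x" "x < q ^ Suc i"
  using ex_power_ivl1[of q x] assms by auto

text \<open>
  Otherwise $N q^j / r$, with $j$ maximal such that $q^j < r$, is smaller than $N$ but at least
  as abundant.
\<close>

lemma superabundant_power_gt:
  assumes N: "superabundant N" and r: "prime r" "r dvd N" and q: "prime q" "q < r"
  shows "real (q ^ Suc (multiplicity q N)) > real r - sqrt (real r)"
proof (rule ccontr)
  define a where "a = multiplicity q N"
  assume "\<not> ?thesis"
  hence le: "real (q ^ Suc a) \<le> real r - sqrt (real r)" by (simp add: a_def)
  have q2: "q \<ge> 2" and r2: "r \<ge> 2" using q r by (auto intro: prime_ge_2_nat)
  have "N > 0" using N by (simp add: superabundant_def)
  then obtain N' where N': "N = N' * r" "N' > 0" using r(2) by (auto elim!: dvdE)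
  obtain j where j: "q ^ j \<le> r - 1" "r - 1 < q ^ Suc j"
    using exists_power_between[OF q2, of "r - 1"] r2 by auto
  have jr: "q ^ j < r" "r \<le> q * q ^ j" using j r2 by auto
  \<comment> \<open>Together with \<open>r <= q * q ^ j\<close> this gives
    \<open>r <= (q ^ j) ^ 2\<close>, so \<open>sqrt r\<close> can be traded for
    \<open>q ^ j\<close>.\<close>
  have "q \<le> q ^ j"
  proof -
    have "j \<noteq> 0" using j(2) q(2) by (intro notI) simp
    thus ?thesis using q2 by (simp add: self_le_power)
  qed
  hence "r \<le> (q ^ j) ^ 2" using jr(2) by (metis le_trans mult_le_mono1 power2_eq_square)
  hence "real r \<le> real (q ^ j) ^ 2" by (metis of_nat_le_iff of_nat_power)
  hence sq: "sqrt (real r) \<le> real (q ^ j)" by (simp add: real_le_lsqrt)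
  have "real (q ^ Suc a) \<le> real r * (1 - 1 / sqrt (real r))"
    using le r2 by (simp add: right_diff_distrib real_div_sqrt)
  also have "\<dots> \<le> real r * (1 - 1 / real (q ^ j))"
    using sq r2 q2 by (intro mult_left_mono diff_left_mono divide_left_mono) auto
  \<comment> \<open>The left side bounds the relative gain of restoring \<open>r\<close> to
    \<open>N'\<close>; the right side is a lower bound for the gain of multiplying by
    \<open>q ^ j\<close> instead.\<close>
  finally have main: "1 / real r \<le> (1 - 1 / real (q ^ j)) / real (q ^ Suc a)"
    using q2 r2 by (simp add: field_simps)
  have "multiplicity q N = multiplicity q N'"
    unfolding N'(1) using q r N' by (subst prime_elem_multiplicity_mult_distrib)
      (auto intro: prime_multiplicity_other)
  hence ma: "multiplicity q N' = a" by (simp add: a_def)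
  have "abundancy N \<le> abundancy N' * (1 + geo r 1 / real (r ^ Suc (multiplicity r N')))"
    using abundancy_mult_prime_power_le[OF r(1) N'(2), of 1] by (simp add: N'(1))
  also have "\<dots> \<le> abundancy N' * (1 + 1 / real r)"
  proof -
    have "real r \<le> real (r ^ Suc (multiplicity r N'))"
      using r2 by (metis Suc_le_eq of_nat_mono self_le_power zero_less_Suc le_trans one_le_numeral)
    thus ?thesis using r2 abundancy_pos[OF N'(2)]
      by (intro mult_left_mono add_left_mono) (auto simp: geo_def intro!: divide_left_mono)
  qed
  also have "\<dots> \<le> abundancy N' * (1 + (1 - 1 / real (q ^ j)) / real (q ^ Suc a))"
    using main abundancy_pos[OF N'(2)] by (intro mult_left_mono add_left_mono) auto
  also have "\<dots> \<le> abundancy (N' * q ^ j)"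
    using abundancy_mult_prime_power_ge[OF q(1) N'(2), of j] by (simp add: ma)
  also have "\<dots> < abundancy N"
    using superabundant_less[OF N, of "N' * q ^ j"] jr(1) N' q2 by simp
  finally show False by simp
qed

text \<open>If a prime \<open>q\<close> divided \<open>n\<close> more often than \<open>N\<close>,
  then \<open>q ^ Suc (multiplicity q N) <= n <= r - sqrt r\<close>, against
  \<open>superabundant_power_gt\<close>.\<close>

lemma superabundant_dvd:
  assumes N: "superabundant N" and r: "prime r" "r dvd N"
    and n: "n > 0" "real n \<le> real r - sqrt (real r)"
  shows "n dvd N"
proof (rule multiplicity_le_imp_dvd)
  show "n \<noteq> 0" using n by simp
  fix q :: nat assume q: "prime q"
  show "multiplicity q n \<le> multiplicity q N"
  proof (rule ccontr)
    assume "\<not> ?thesis"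
    hence "q ^ Suc (multiplicity q N) dvd n"
      by (intro multiplicity_dvd') simp
    hence le: "q ^ Suc (multiplicity q N) \<le> n" using n(1) by (simp add: dvd_imp_le)
    have "r \<ge> 2" using r(1) by (rule prime_ge_2_nat)
    hence "n < r" using n by (smt (verit) of_nat_less_iff of_nat_0_less_iff real_sqrt_gt_0_iff not_numeral_le_zero gr0I)
    moreover have "q \<le> q ^ Suc (multiplicity q N)" using prime_ge_1_nat[OF q] by simp
    ultimately have "q < r" using le by linarith
    from superabundant_power_gt[OF N r q this] le n(2) show False
      by (smt (verit) of_nat_le_iff)
  qed
qed

text \<open>
  Compare $N$ with $N s / q^i$, where $i$ is minimal such that $q^i > s$.
\<close>

lemma superabundant_prime_power_le:
  assumes N: "superabundant N" and s: "prime s" "\<not> s dvd N" and q: "prime q"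
  shows "q ^ multiplicity q N \<le> 2 * s ^ 2"
proof -
  define a where "a = multiplicity q N"
  have q2: "q \<ge> 2" and s2: "s \<ge> 2" using q s by (auto intro: prime_ge_2_nat)
  obtain k where k: "q ^ k \<le> s" "s < q ^ Suc k"
    using exists_power_between[OF q2, of s] s2 by auto
  define i where "i = Suc k"
  have "N > 0" using N by (simp add: superabundant_def)
  show ?thesis
  proof (cases "i \<le> a")
    case False
    hence "q ^ a \<le> q ^ k" using q2 by (intro power_increasing) (auto simp: i_def)
    also have "\<dots> \<le> s" by (rule k)
    also have "\<dots> \<le> 2 * s ^ 2" by (simp add: power2_eq_square)
    finally show ?thesis by (simp add: a_def)
  next
    case True
    hence "q ^ i dvd N" unfolding a_def by (rule multiplicity_dvd')
    then obtain N' where N': "N = N' * q ^ i" "N' > 0" using \<open>N > 0\<close> by (auto elim!: dvdE)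
    have "a = multiplicity q N' + i"
      unfolding a_def N'(1) using q N' q2 by (subst prime_elem_multiplicity_mult_distrib) auto
    hence a: "multiplicity q N' = a - i" by simp
    have "\<not> s dvd N'" using s N'(1) by auto
    hence "abundancy N' * (1 + 1 / real s) = abundancy (N' * s)"
      using abundancy_mult_new_prime[OF s(1) _ N'(2)] by simp
    also have "\<dots> < abundancy N"
      using superabundant_less[OF N, of "N' * s"] k(2) N' s2 by (simp add: i_def)
    also have "\<dots> \<le> abundancy N' * (1 + geo q i / real (q ^ Suc (a - i)))"
      using abundancy_mult_prime_power_le[OF q N'(2), of i] by (simp add: a N'(1))
    finally have "1 / real s < geo q i / real (q ^ Suc (a - i))"
      using abundancy_pos[OF N'(2)] by simp
    also have "\<dots> \<le> 2 / real (q ^ Suc (a - i))"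
      using geo_bounds(2)[OF q2] by (intro divide_right_mono) auto
    finally have "real (q ^ Suc (a - i)) < real (2 * s)"
      using s2 q2 by (simp add: field_simps)
    hence "q ^ Suc (a - i) < 2 * s" by linarith
    \<comment> \<open>Multiplying by \<open>q ^ k <= s\<close> restores the exponent
      \<open>a\<close>, because \<open>i = k + 1\<close>.\<close>
    hence "q ^ Suc (a - i) * q ^ k \<le> (2 * s) * s" using k(1) by (intro mult_mono) auto
    also have "q ^ Suc (a - i) * q ^ k = q ^ a"
      using True by (simp add: i_def flip: power_add power_Suc)
    finally show ?thesis by (simp add: a_def power2_eq_square mult.assoc)
  qed
qed

text \<open>
  Compare $N$ with $N s / (q r)$: the two squares together lose at most a factor
  $(1 + 1/(3s))^2$, less than the factor $1 + 1/s$ gained from $s$.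
\<close>

lemma superabundant_large_square_unique:
  assumes N: "superabundant N" and s: "prime s" "\<not> s dvd N"
    and q: "prime q" "multiplicity q N \<ge> 2" "q ^ 2 \<ge> 3 * s"
    and r: "prime r" "multiplicity r N \<ge> 2" "r ^ 2 \<ge> 3 * s"
  shows "q = r"
proof (rule ccontr)
  assume "q \<noteq> r"
  have pos: "q \<ge> 2" "r \<ge> 2" "s \<ge> 2" using q r s by (auto intro: prime_ge_2_nat)
  have "N > 0" using N by (simp add: superabundant_def)
  have "q dvd N" "r dvd N"
    using q r by (metis multiplicity_dvd' power_one_right one_le_numeral le_trans)+
  moreover have "coprime q r" using q(1) r(1) \<open>q \<noteq> r\<close> by (simp add: primes_coprime)
  ultimately have "q * r dvd N" by (simp add: divides_mult)
  then obtain N' where N': "N = N' * r * q" "N' > 0"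
    using \<open>N > 0\<close> by (auto elim!: dvdE simp: mult_ac)
  have "multiplicity q N = multiplicity q (N' * r) + 1" "multiplicity r N = multiplicity r N' + 1"
    unfolding N'(1) using q r N' pos \<open>q \<noteq> r\<close>
    by (simp_all add: prime_elem_multiplicity_mult_distrib prime_multiplicity_other)
  hence mult: "multiplicity q (N' * r) \<ge> 1" "multiplicity r N' \<ge> 1" using q r by simp_all
  \<comment> \<open>As \<open>t\<close> already divides \<open>n\<close>, one more factor
    \<open>t\<close> yields an exponent of at least 2, so the relative gain is at most
    \<open>1 / t ^ 2 <= 1 / (3 * s)\<close>.\<close>
  have step: "abundancy (n * t) \<le> abundancy n * (1 + 1 / (3 * real s))"
    if t: "prime t" "multiplicity t n \<ge> 1" "t ^ 2 \<ge> 3 * s" "n > 0" for t n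
  proof -
    have "t \<ge> 2" using t by (simp add: prime_ge_2_nat)
    have "t ^ 2 \<le> t ^ Suc (multiplicity t n)" using t(2) \<open>t \<ge> 2\<close> by (intro power_increasing) auto
    hence "3 * s \<le> t ^ Suc (multiplicity t n)" using t(3) by simp
    hence "real (3 * s) \<le> real (t ^ Suc (multiplicity t n))" by (rule of_nat_mono)
    hence "1 / real (t ^ Suc (multiplicity t n)) \<le> 1 / (3 * real s)"
      using \<open>s \<ge> 2\<close> by (intro divide_left_mono) (auto simp: mult_pos_pos)
    moreover have "abundancy (n * t) \<le> abundancy n * (1 + 1 / real (t ^ Suc (multiplicity t n)))"
      using abundancy_mult_prime_power_le[OF t(1,4), of 1] by (simp add: geo_def)
    ultimately show ?thesis using abundancy_pos[OF t(4)]
      by (smt (verit) mult_left_mono)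
  qed
  \<comment> \<open>This makes \<open>N' * s\<close> smaller than \<open>N = N' * r * q\<close>, so
    that superabundance applies.\<close>
  have less: "s < r * q"
  proof -
    have "(3 * s) * (3 * s) \<le> q ^ 2 * r ^ 2" using q r by (intro mult_mono) auto
    hence "(3 * s) ^ 2 \<le> (r * q) ^ 2" by (simp add: power2_eq_square mult_ac)
    hence "3 * s \<le> r * q" by (rule power2_le_imp_le) simp
    thus ?thesis using pos by simp
  qed
  have "\<not> s dvd N'" using s N'(1) by auto
  hence "abundancy N' * (1 + 1 / real s) = abundancy (N' * s)"
    using abundancy_mult_new_prime[OF s(1) _ N'(2)] by simp
  also have "\<dots> < abundancy N"
    using superabundant_less[OF N, of "N' * s"] less N' pos by (simp add: mult.assoc)
  also have "\<dots> \<le> abundancy (N' * r) * (1 + 1 / (3 * real s))"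
    unfolding N'(1) using q mult N' pos by (intro step) auto
  also have "\<dots> \<le> abundancy N' * (1 + 1 / (3 * real s)) * (1 + 1 / (3 * real s))"
    using r mult N' pos by (intro mult_right_mono step) auto
  finally have "1 + 1 / real s < (1 + 1 / (3 * real s)) * (1 + 1 / (3 * real s))"
    using abundancy_pos[OF N'(2)] by (simp add: mult.assoc)
  thus False using pos by (simp add: field_simps)
qed


section \<open>Elementary bounds on primes\<close>

lemma prod_primes_dvd:
  fixes n :: nat
  assumes "finite A" "\<And>p. p \<in> A \<Longrightarrow> prime p \<and> p dvd n"
  shows "\<Prod>A dvd n"
  using assms
proof (induction A rule: finite_induct)
  case (insert p A)
  have "coprime p (\<Prod>A)"
    using insert by (intro prod_coprime_right primes_coprime) auto
  thus ?case using insert by (simp add: divides_mult)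
qed simp

text \<open>Erdos's induction: an even \<open>n > 2\<close> is not prime, and for
  \<open>n = 2 * m + 1\<close> the primes in \<open>(m + 1, n]\<close> all divide
  \<open>2 * m + 1 choose m\<close>, which is at most \<open>4 ^ m\<close>.\<close>

lemma primorial_le: "(\<Prod>p | prime p \<and> p \<le> n. p) \<le> (4::nat) ^ n"
proof (induction n rule: less_induct)
  case (less n)
  consider "n \<le> 1" | "n = 2" | "n > 2" "even n" | "n > 2" "odd n"
    by (atomize_elim) arith
  thus ?case
  proof cases
    case 1
    hence empty: "{p. prime p \<and> p \<le> n} = {}" by (auto dest: prime_gt_1_nat)
    show ?thesis unfolding empty by simp
  next
    case 2
    hence two: "{p. prime p \<and> p \<le> n} = {2}" by (auto dest: prime_ge_2_nat)
    show ?thesis unfolding two using 2 by simp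
  next
    case 3
    have "\<not> prime n" using 3 by (metis prime_odd_nat)
    hence "{p. prime p \<and> p \<le> n} = {p. prime p \<and> p \<le> n - 1}"
      using 3 by (auto simp: le_less intro: ccontr)
    hence "(\<Prod>p | prime p \<and> p \<le> n. p) \<le> 4 ^ (n - 1)" using less[of "n - 1"] 3 by simp
    also have "\<dots> \<le> (4::nat) ^ n" by (rule power_increasing) auto
    finally show ?thesis .
  next
    case 4
    then obtain m where n: "n = 2 * m + 1" by (elim oddE)
    hence m: "m \<ge> 1" using 4 by simp
    have split: "{p. prime p \<and> p \<le> n} = {p. prime p \<and> p \<le> m + 1} \<union> {p. prime p \<and> m + 1 < p \<and> p \<le> n}"
      using n by auto
    have "(\<Prod>p | prime p \<and> m + 1 < p \<and> p \<le> n. p) dvd (2 * m + 1 choose m)"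
    proof (rule prod_primes_dvd)
      fix p assume p: "p \<in> {p. prime p \<and> m + 1 < p \<and> p \<le> n}"
      have "fact m * fact (m + 1) * (2 * m + 1 choose m) = (fact n :: nat)"
        using binomial_fact_lemma[of m "2 * m + 1"] by (simp add: n)
      moreover have "p dvd (fact n :: nat)" using p by (subst prime_dvd_fact_iff) auto
      moreover have "\<not> p dvd (fact m :: nat)" "\<not> p dvd (fact (m + 1) :: nat)"
        using p by (subst prime_dvd_fact_iff; auto)+
      ultimately show "prime p \<and> p dvd (2 * m + 1 choose m)"
        using p by (metis (lifting) mem_Collect_eq prime_dvd_mult_iff)
    qed simp
    hence "(\<Prod>p | prime p \<and> m + 1 < p \<and> p \<le> n. p) \<le> (2 * m + 1 choose m)"
      by (rule dvd_imp_le) simp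
    also have "\<dots> \<le> 4 ^ m"
    proof -
      \<comment> \<open>The two equal middle binomials both occur in the row sum
        \<open>2 ^ (2 * m + 1)\<close>, so each is at most half of it.\<close>
      have "(2 * m + 1 choose m) + (2 * m + 1 choose (m + 1)) = (\<Sum>k\<in>{m, m + 1}. 2 * m + 1 choose k)"
        by simp
      also have "\<dots> \<le> (\<Sum>k\<le>2 * m + 1. 2 * m + 1 choose k)" by (intro sum_mono2) auto
      also have "\<dots> = 2 ^ (2 * m + 1)" by (rule choose_row_sum)
      also have "(2 * m + 1 choose (m + 1)) = (2 * m + 1 choose m)"
        using binomial_symmetric[of m "2 * m + 1"] by simp
      finally show ?thesis by (simp add: power_mult)
    qed
    finally have "(\<Prod>p | prime p \<and> p \<le> n. p) \<le> 4 ^ (m + 1) * (4::nat) ^ m"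
      unfolding split using less[of "m + 1"] m n by (subst prod.union_disjoint) (auto intro!: mult_mono)
    also have "\<dots> = 4 ^ n" by (simp add: n mult_2 power_add)
    finally show ?thesis .
  qed
qed

text \<open>
  The induction follows the recurrence $1/(k {m \choose k}) = 1/(k {m-1 \choose k}) -
  1/((k+1) {m \choose k+1})$ of the Leibniz harmonic triangle.
\<close>

lemma times_binomial_dvd:
  assumes "\<And>i. 1 \<le> i \<Longrightarrow> i \<le> m \<Longrightarrow> i dvd L" "1 \<le> k" "k \<le> m"
  shows "k * (m choose k) dvd L"
  using assms
proof (induction "m - k" arbitrary: m k)
  case 0
  thus ?case by simp
next
  case (Suc d)
  \<comment> \<open>Both neighbours in the triangle, \<open>(m, k + 1)\<close> and
    \<open>(m - 1, k)\<close>, have a difference smaller by one; the base case \<open>k = m\<close>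
    is the hypothesis on \<open>L\<close>.\<close>
  have IH1: "(k + 1) * (m choose (k + 1)) dvd L"
    using Suc by (intro Suc.hyps(1)) auto
  have IH2: "k * ((m - 1) choose k) dvd L"
    using Suc by (intro Suc.hyps(1)) auto
  obtain n where n: "m = Suc n" "k \<le> n" using Suc by (cases m) auto
  have pos: "(m choose (k + 1)) > 0" "(n choose k) > 0" "(m choose k) > 0" "k > 0"
    using n Suc by auto
  have e1: "real (k + 1) * real (m choose (k + 1)) = real m * real (n choose k)"
    using Suc_times_binomial[of k n] unfolding n(1) by (metis Suc_eq_plus1 of_nat_mult)
  have e2: "real (m - k) * real (m choose k) = real m * real (n choose k)"
    using binomial_absorb_comp[of m k] n by (metis diff_Suc_1 of_nat_mult)
  define C where "C = real (n choose k)"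
  have C: "C > 0" using pos by (simp add: C_def)
  have mk: "real (m - k) = real m - real k" using n by auto
  have mk0: "real m - real k > 0" "real m > 0" using n by auto
  have B: "real (m choose k) = real m * C / (real m - real k)"
    using e2 mk0 unfolding C_def mk by (simp add: field_simps)
  have *: "1 / (real k * real (m choose k)) =
        1 / (real k * C) - 1 / (real (k + 1) * real (m choose (k + 1)))"
    unfolding e1 B C_def[symmetric] using C mk0 pos by (simp add: field_simps)
  obtain u where u: "L = (k + 1) * (m choose (k + 1)) * u" using IH1 by (elim dvdE)
  obtain v where v: "L = k * (n choose k) * v" using IH2 n by (auto elim: dvdE)
  \<comment> \<open>Multiplying the recurrence by \<open>L\<close> exhibits this quotient as a
    difference of integers.\<close>
  have "real L / (real k * real (m choose k)) = real v - real u"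
  proof -
    have "real L / (real k * C) = real v"
      using v pos by (simp add: C_def)
    moreover have "real L / (real (k + 1) * real (m choose (k + 1))) = real u"
      unfolding u of_nat_mult using pos by simp
    ultimately show ?thesis using arg_cong[OF *, of "\<lambda>x. real L * x"]
      by (simp only: right_diff_distrib times_divide_eq_right mult_1_right)
  qed
  hence "real L = (real v - real u) * (real k * real (m choose k))"
    using pos by (simp add: field_simps)
  hence "real_of_int (int L) = real_of_int ((int v - int u) * int (k * (m choose k)))" by simp
  hence "int L = (int v - int u) * int (k * (m choose k))" by linarith
  hence "int (k * (m choose k)) dvd int L" by (metis dvd_triv_right)
  thus ?case by (simp only: of_nat_dvd_iff)
qed

text \<open>A Chebyshev-type lower bound for the number of primes. Each \<open>m choose k\<close>
  with \<open>1 <= k <= m\<close> is at most \<open>L\<close>, the least common multiple of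
  \<open>1, ..., m\<close>, and each prime contributes to \<open>L\<close> a power of at most
  \<open>m\<close>.\<close>

lemma power_le_card_primes:
  assumes "m \<ge> 1"
  shows "2 ^ m \<le> 1 + m * m ^ card {p. prime p \<and> p \<le> m}"
proof -
  define P where "P = {p::nat. prime p \<and> p \<le> m}"
  define e where "e = (\<lambda>p. Max {k. p ^ k \<le> m})"
  define L where "L = (\<Prod>p\<in>P. p ^ e p)"
  \<comment> \<open>The estimate \<open>k < p ^ k\<close> bounds the exponents, so
    \<open>Max\<close> is taken over a finite nonempty set.\<close>
  have fin: "finite {k. p ^ k \<le> m}" and pe: "p ^ e p \<le> m" if "prime p" for p
  proof -
    have "p \<ge> 2" using that by (rule prime_ge_2_nat)
    hence "k < p ^ k" for k 
      using power_mono[of 2 p k] less_exp[of k] by linarith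
    hence "{k. p ^ k \<le> m} \<subseteq> {..m}" 
      by (force intro: less_imp_le less_le_trans)
    thus f: "finite {k. p ^ k \<le> m}" by (rule finite_subset) simp
    have "0 \<in> {k. p ^ k \<le> m}" using assms by simp
    hence "Max {k. p ^ k \<le> m} \<in> {k. p ^ k \<le> m}" using Max_in[OF f] by blast
    thus "p ^ e p \<le> m" by (simp add: e_def)
  qed
  have finP: "finite P" by (simp add: P_def)
  have Lpos: "L > 0" unfolding L_def by (rule prod_pos) (auto simp: P_def prime_gt_0_nat)
  have dvd: "i dvd L" if i: "1 \<le> i" "i \<le> m" for i
  proof (rule multiplicity_le_imp_dvd)
    show "i \<noteq> 0" using i by simp
    fix p :: nat assume p: "prime p"
    have le: "p ^ multiplicity p i \<le> i" using i by (intro dvd_imp_le multiplicity_dvd) auto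
    show "multiplicity p i \<le> multiplicity p L"
    proof (cases "p \<in> P")
      case True
      have "multiplicity p i \<le> e p"
        unfolding e_def using le i fin[OF p] by (intro Max_ge) auto
      also have "p ^ e p dvd L" unfolding L_def using True finP by (intro dvd_prodI)
      hence "e p \<le> multiplicity p L" using Lpos p
        by (intro multiplicity_geI) (auto simp: prime_gt_0_nat not_prime_unit)
      finally show ?thesis .
    next
      case False
      hence "\<not> p dvd i" using i p by (auto simp: P_def dest: dvd_imp_le)
      thus ?thesis by (simp add: not_dvd_imp_multiplicity_0)
    qed
  qed
  have "2 ^ m = (\<Sum>k\<le>m. m choose k)" by (rule choose_row_sum[symmetric])
  also have "\<dots> = 1 + (\<Sum>k=1..m. m choose k)"
    by (simp add: atMost_atLeast0 sum.atLeast_Suc_atMost)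
  also have "(\<Sum>k=1..m. m choose k) \<le> (\<Sum>k=1..m. L)"
  proof (rule sum_mono)
    fix k assume k: "k \<in> {1..m}"
    have "m choose k \<le> k * (m choose k)" using k by simp
    also have "k * (m choose k) dvd L" using k dvd by (intro times_binomial_dvd) auto
    hence "k * (m choose k) \<le> L" using Lpos by (rule dvd_imp_le)
    finally show "m choose k \<le> L" .
  qed
  also have "(\<Sum>k=1..m. L) = m * L" by simp
  also have "L \<le> (\<Prod>p\<in>P. m)" unfolding L_def by (rule prod_mono) (auto simp: P_def pe)
  hence "m * L \<le> m * m ^ card P" by simp
  finally show ?thesis by (simp add: P_def)
qed

text \<open>A weak form of Bertrand's postulate. Without such an \<open>s\<close>, all primes up to
  \<open>m\<close>, the floor of \<open>p powr (3/2)\<close>, are at most \<open>p\<close>, so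
  \<open>2 ^ m <= 1 + m ^ (p + 1)\<close>. Taking logarithms, the left side has order
  \<open>p powr (3/2)\<close>, the right only \<open>p * ln p\<close>.\<close>

lemma eventually_prime_between:
  "eventually (\<lambda>p::nat. \<exists>s. prime s \<and> p < s \<and> real s \<le> real p powr (3 / 2)) at_top"
proof -
  have "eventually (\<lambda>p::nat. (real p powr (3/2) - 1) * ln 2 >
      ln 2 + (real p + 1) * ln (real p powr (3/2))) at_top"
    by real_asymp
  moreover have "eventually (\<lambda>p::nat. p \<ge> 2) at_top" by (rule eventually_ge_at_top)
  ultimately show ?thesis
  proof eventually_elim
    case (elim p)
    define m where "m = nat \<lfloor>real p powr (3/2)\<rfloor>"
    have "real p powr (3/2) \<ge> 1" using elim by (simp add: ge_one_powr_ge_zero)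
    hence m: "m \<ge> 1" "real m \<le> real p powr (3/2)" "real m > real p powr (3/2) - 1"
      unfolding m_def by linarith+
    show ?case
    proof (rule ccontr)
      assume *: "\<not> ?case"
      have "{q. prime q \<and> q \<le> m} \<subseteq> {1..p}"
      proof safe
        fix q assume q: "prime q" "q \<le> m"
        hence "real q \<le> real p powr (3/2)" using m(2) by linarith
        with * q show "q \<in> {1..p}" using prime_ge_1_nat[OF q(1)] by (auto simp: not_less)
      qed
      hence "card {q. prime q \<and> q \<le> m} \<le> card {1..p}" by (rule card_mono[rotated]) simp
      hence "card {q. prime q \<and> q \<le> m} \<le> p" by simp
      hence "m * m ^ card {q. prime q \<and> q \<le> m} \<le> m * m ^ p"
        using m(1) by (intro mult_left_mono power_increasing) auto
      hence "2 ^ m \<le> 1 + m * m ^ p" using power_le_card_primes[OF m(1)] by linarith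
      also have "\<dots> = 1 + m ^ (p + 1)" by simp
      also have "\<dots> \<le> 2 * m ^ (p + 1)" using one_le_power[OF m(1), of "p + 1"] by linarith
      finally have "real (2 ^ m) \<le> real (2 * m ^ (p + 1))" by (rule of_nat_mono)
      hence "ln (real (2 ^ m)) \<le> ln (real (2 * m ^ (p + 1)))" using m(1) by (subst ln_le_cancel_iff) auto
      also have "\<dots> = ln 2 + (real p + 1) * ln (real m)"
        using m(1) by (simp add: ln_mult ln_realpow algebra_simps)
      also have "\<dots> \<le> ln 2 + (real p + 1) * ln (real p powr (3/2))"
        using m by (intro add_left_mono mult_left_mono ln_mono) auto
      also have "\<dots> < (real p powr (3/2) - 1) * ln 2" by (rule elim)
      also have "\<dots> \<le> real m * ln 2" using m(3) by (intro mult_right_mono) auto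
      also have "\<dots> = ln (real (2 ^ m))" by (simp add: ln_realpow)
      finally show False by simp
    qed
  qed
qed


section \<open>Small divisors and the first cutoff\<close>

lemma prime_ln_sum_le: "(\<Sum>p | prime p \<and> p \<le> n. ln (real p)) \<le> real n * ln 4"
proof -
  have "(\<Sum>p | prime p \<and> p \<le> n. ln (real p)) = ln (\<Prod>p | prime p \<and> p \<le> n. real p)"
    by (subst ln_prod) (auto simp: prime_gt_0_nat)
  also have "\<dots> = ln (real (\<Prod>p | prime p \<and> p \<le> n. p))" by simp
  also have "\<dots> \<le> ln (real (4 ^ n))"
  proof -
    have "(\<Prod>p | prime p \<and> p \<le> n. p) > (0::nat)" by (rule prod_pos) (auto simp: prime_gt_0_nat)
    moreover have "real (\<Prod>p | prime p \<and> p \<le> n. p) \<le> real (4 ^ n)"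
      by (intro of_nat_mono primorial_le)
    ultimately show ?thesis by (subst ln_le_cancel_iff) (auto simp del: of_nat_prod)
  qed
  also have "\<dots> = real n * ln 4" by (simp add: ln_realpow)
  finally show ?thesis .
qed

text \<open>Prime factors of multiplicity one contribute at most the Chebyshev sum up to
  \<open>p\<close>. Each other prime power is at most \<open>2 * s ^ 2\<close>, and there are few of
  them: those below \<open>sqrt (3 * s)\<close> are counted as integers, and from there on
  \<open>superabundant_large_square_unique\<close> leaves at most one.\<close>

lemma superabundant_ln_le:
  assumes N: "superabundant N" and s: "prime s" "\<not> s dvd N"
    and p: "\<And>q. prime q \<Longrightarrow> q dvd N \<Longrightarrow> q \<le> p"
  shows "ln (real N) \<le> real p * ln 4 + (sqrt (3 * real s) + 2) * ln (2 * real s ^ 2)"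
proof -
  define m where "m = (\<lambda>q. multiplicity q N)"
  define U where "U = {q \<in> prime_factors N. m q \<ge> 2}"
  define T where "T = prime_factors N - U"
  define B where "B = ln (2 * real s ^ 2)"
  have "N > 0" using N by (simp add: superabundant_def)
  have s1: "s \<ge> 1" using s(1) by (rule prime_ge_1_nat)
  have B0: "B \<ge> 0" 
  proof -
    have "1 \<le> real s ^ 2" using s1 by (intro one_le_power) simp
    thus ?thesis unfolding B_def by (intro ln_ge_zero) linarith
  qed
  have fin: "finite U" "finite T" by (simp_all add: U_def T_def)
  have pos: "q > 0" if "q \<in> prime_factors N" for q
    using that by (auto intro: prime_gt_0_nat)
  have "real N = (\<Prod>q\<in>prime_factors N. real (q ^ m q))"
    using prime_factorization_nat[OF \<open>N > 0\<close>] unfolding m_def by (metis of_nat_prod)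
  hence "ln (real N) = (\<Sum>q\<in>prime_factors N. ln (real (q ^ m q)))"
    by (simp only:) (subst ln_prod; use pos in auto)
  also have "\<dots> = (\<Sum>q\<in>T. ln (real (q ^ m q))) + (\<Sum>q\<in>U. ln (real (q ^ m q)))"
    unfolding T_def by (rule sum.subset_diff) (auto simp: U_def)
  also have "(\<Sum>q\<in>T. ln (real (q ^ m q))) \<le> (\<Sum>q | prime q \<and> q \<le> p. ln (real q))"
  proof -
    have "m q = 1" if "q \<in> T" for q
      using that prime_factors_multiplicity[of N] by (fastforce simp: T_def U_def m_def)
    hence "(\<Sum>q\<in>T. ln (real (q ^ m q))) = (\<Sum>q\<in>T. ln (real q))" by (intro sum.cong) auto
    also have "\<dots> \<le> (\<Sum>q | prime q \<and> q \<le> p. ln (real q))"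
      by (rule sum_mono2) (auto simp: T_def intro: p intro!: ln_ge_zero dest: prime_ge_1_nat)
    finally show ?thesis .
  qed
  also have "\<dots> \<le> real p * ln 4" by (rule prime_ln_sum_le)
  also have "(\<Sum>q\<in>U. ln (real (q ^ m q))) \<le> (\<Sum>q\<in>U. B)"
  proof (rule sum_mono)
    fix q assume "q \<in> U"
    hence q: "prime q" by (auto simp: U_def)
    have "q ^ m q \<le> 2 * s ^ 2"
      unfolding m_def by (rule superabundant_prime_power_le[OF N s q])
    hence "real (q ^ m q) \<le> real (2 * s ^ 2)" by (rule of_nat_mono)
    thus "ln (real (q ^ m q)) \<le> B"
      unfolding B_def using prime_gt_0_nat[OF q] by (intro ln_mono) auto
  qed
  also have "\<dots> = real (card U) * B" by simp
  also have "\<dots> \<le> (sqrt (3 * real s) + 2) * B"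
  proof (rule mult_right_mono)
    define V where "V = {q \<in> U. q ^ 2 \<ge> 3 * s}"
    \<comment> \<open>Any two elements of \<open>V\<close> coincide, so one arbitrary choice covers
      \<open>V\<close>, even if \<open>V\<close> is empty.\<close>
    have "V \<subseteq> {SOME q. q \<in> V}"
    proof
      fix q assume q: "q \<in> V"
      hence "(SOME q. q \<in> V) \<in> V" by (rule someI)
      with q have "q = (SOME q. q \<in> V)"
        by (intro superabundant_large_square_unique[OF N s]) (auto simp: V_def U_def m_def)
      thus "q \<in> {SOME q. q \<in> V}" by simp
    qed
    hence "card V \<le> card {SOME q. q \<in> V}" by (intro card_mono) auto
    hence V: "card V \<le> 1" by simp
    have "U - V \<subseteq> {..nat \<lfloor>sqrt (3 * real s)\<rfloor>}"
    proof
      fix q assume "q \<in> U - V"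
      hence "q ^ 2 < 3 * s" by (auto simp: V_def)
      hence "real (q ^ 2) < real (3 * s)" by (simp only: of_nat_less_iff)
      hence "real q < sqrt (3 * real s)" by (simp add: real_less_rsqrt)
      thus "q \<in> {..nat \<lfloor>sqrt (3 * real s)\<rfloor>}" by (simp add: le_nat_floor)
    qed
    hence "card (U - V) \<le> card {..nat \<lfloor>sqrt (3 * real s)\<rfloor>}" by (intro card_mono) auto
    \<comment> \<open>The range starts at 0, hence \<open>Suc\<close>; the possible element of
      \<open>V\<close> then turns \<open>+ 1\<close> into \<open>+ 2\<close>.\<close>
    hence "card (U - V) \<le> Suc (nat \<lfloor>sqrt (3 * real s)\<rfloor>)" by simp
    moreover have "real (nat \<lfloor>sqrt (3 * real s)\<rfloor>) \<le> sqrt (3 * real s)"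
      by (rule of_nat_floor) simp
    ultimately have "real (card (U - V)) \<le> sqrt (3 * real s) + 1" by linarith
    moreover have "card U = card V + card (U - V)"
      using fin(1) card_mono[of U V] card_Diff_subset[of V U] by (auto simp: V_def)
    ultimately show "real (card U) \<le> sqrt (3 * real s) + 2" using V by simp
  qed (rule B0)
  finally show ?thesis by (simp add: B_def)
qed

text \<open>
  The constant $7/10$ lies strictly between $e^{-\gamma} \approx 0.561$ and
  $1 / \ln 4 \approx 0.721$.
\<close>

lemma eventually_superabundant_dvd:
  "eventually (\<lambda>N. \<forall>n>0. real n \<le> 7/10 * ln (real N) \<longrightarrow> n dvd N)
     (inf at_top (principal {N. superabundant N}))"
proof -
  define F where "F = (\<lambda>p s. p * ln 4 + (sqrt (3 * s) + 2) * ln (2 * s ^ 2 :: real))"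
  \<comment> \<open>The constants: \<open>ln 4 = 2 * ln 2 <= 25/18 < 14/10\<close> leaves room for
    the lower-order term, and \<open>7/10 * 14/10 = 98/100\<close> is the fraction of
    \<open>p\<close> that has to stay below \<open>p - sqrt p\<close>.\<close>
  have "eventually (\<lambda>p::nat. 25/18 * real p + (sqrt (3 * (real p powr (3/2))) + 2) *
      ln (2 * (real p powr (3/2)) ^ 2) \<le> 14/10 * real p) at_top"
    by real_asymp
  moreover have "eventually (\<lambda>p::nat. 98/100 * real p \<le> real p - sqrt (real p)) at_top"
    by real_asymp
  moreover have "eventually (\<lambda>p::nat. p \<ge> 1) at_top" by (rule eventually_ge_at_top)
  ultimately have "eventually (\<lambda>p::nat. 98/100 * real p \<le> real p - sqrt (real p) \<and>
      (\<exists>s. prime s \<and> p < s \<and> F (real p) (real s) \<le> 14/10 * real p)) at_top"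
    using eventually_prime_between
  proof eventually_elim
    case (elim p)
    then obtain s where s: "prime s" "p < s" "real s \<le> real p powr (3/2)" by blast
    have s1: "real s \<ge> 1" using prime_ge_1_nat[OF s(1)] by simp
    have "ln (4::real) \<le> 25/18"
      using ln2_le_25_over_36 ln_realpow[of 2 2] by simp
    hence "real p * ln 4 \<le> 25/18 * real p" 
      using mult_left_mono[of "ln 4" "25/18" "real p"] by (simp add: mult.commute)
    moreover have "(sqrt (3 * real s) + 2) * ln (2 * real s ^ 2) \<le>
        (sqrt (3 * (real p powr (3/2))) + 2) * ln (2 * (real p powr (3/2)) ^ 2)"
      using s s1
      by (intro mult_mono add_right_mono real_sqrt_le_mono mult_left_mono ln_mono power_mono ln_ge_zero)
         (auto intro: add_nonneg_nonneg simp: mult_ge1_I)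
    ultimately have "F (real p) (real s) \<le> 14/10 * real p" using elim(1) unfolding F_def by linarith
    thus ?case using s elim by blast
  qed
  then obtain p0 where p0: "\<And>p. p \<ge> p0 \<Longrightarrow> 98/100 * real p \<le> real p - sqrt (real p) \<and>
      (\<exists>s. prime s \<and> p < s \<and> F (real p) (real s) \<le> 14/10 * real p)"
    by (auto simp: eventually_at_top_linorder)
  \<comment> \<open>Used to force the largest prime factor of \<open>N\<close> up to
    \<open>p0\<close>: were it smaller, \<open>ln N\<close> would be at most the constant
    \<open>F p0 s0\<close>, which fails for large \<open>N\<close>.\<close>
  obtain s0 where s0: "prime s0" "s0 > p0" using bigger_prime by blast
  have "filterlim (\<lambda>N::nat. ln (real N)) at_top at_top" by real_asymp
  hence "eventually (\<lambda>N::nat. ln (real N) > F (real p0) (real s0)) at_top"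
    by (simp add: filterlim_at_top_dense)
  moreover have "eventually (\<lambda>N::nat. N \<ge> 2) at_top" by (rule eventually_ge_at_top)
  ultimately have "eventually (\<lambda>N. superabundant N \<longrightarrow>
      (\<forall>n>0. real n \<le> 7/10 * ln (real N) \<longrightarrow> n dvd N)) at_top"
  proof eventually_elim
    case (elim N)
    show ?case
    proof (intro impI allI)
      fix n :: nat
      assume N: "superabundant N" and n: "n > 0" "real n \<le> 7/10 * ln (real N)"
      define p where "p = Max (prime_factors N)"
      have "prime_factors N \<noteq> {}"
        using elim by (auto simp: prime_factorization_empty_iff)
      hence "p \<in> prime_factors N" unfolding p_def by (intro Max_in) auto
      hence p: "prime p" "p dvd N" by auto
      have max: "q \<le> p" if "prime q" "q dvd N" for q
        unfolding p_def using that elim by (intro Max_ge) (auto intro: prime_factorsI)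
      \<comment> \<open>A prime above the largest prime factor \<open>p\<close> cannot divide
        \<open>N\<close>. Leaving \<open>p'\<close> free allows both \<open>p' = p0\<close> and
        \<open>p' = p\<close>.\<close>
      have bound: "ln (real N) \<le> F (real p') (real s)" if "prime s" "s > p" "p' \<ge> p" for s p'
        unfolding F_def using superabundant_ln_le[OF N that(1), of p'] that max
        by (meson leD le_trans)
      have "p \<ge> p0" using bound[of s0 p0] s0 elim by force
      with p0 obtain s where s: "98/100 * real p \<le> real p - sqrt (real p)" "prime s" "p < s"
        "F (real p) (real s) \<le> 14/10 * real p" by blast
      have "ln (real N) \<le> 14/10 * real p" using bound[of s p] s by simp
      hence "real n \<le> real p - sqrt (real p)" using n s by simp
      thus "n dvd N" by (rule superabundant_dvd[OF N p n(1)])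
    qed
  qed
  thus ?thesis by (simp add: eventually_inf_principal)
qed

section \<open>The divisor list and the first cutoff\<close>

text \<open>The numbers \<open>1, ..., m\<close> followed by the sorted divisors beyond
  \<open>m\<close> form a sorted distinct list of all divisors, hence the divisor list;
  \<open>Suc i\<close> appears because indices start at 0.\<close>

lemma divisors_list_nth:
  assumes "N > 0" "\<And>n. 0 < n \<Longrightarrow> n \<le> m \<Longrightarrow> n dvd N" "i < m"
  shows "divisors_list N ! i = Suc i" "i < length (divisors_list N)"
proof -
  define R where "R = {d. d dvd N \<and> d > m}"
  have fin: "finite R" using assms(1) by (simp add: R_def)
  have "{d. d dvd N} = set ([1..<Suc m] @ sorted_list_of_set R)"
    using assms(1,2) fin by (auto simp: R_def Suc_le_eq not_less less_Suc_eq_le intro!: Nat.gr0I)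
  moreover have "sorted ([1..<Suc m] @ sorted_list_of_set R)"
    using fin by (auto simp: sorted_append R_def simp del: upt_Suc)
  moreover have "distinct ([1..<Suc m] @ sorted_list_of_set R)"
    using fin by (auto simp: R_def)
  ultimately have eq: "divisors_list N = [1..<Suc m] @ sorted_list_of_set R"
    unfolding divisors_list_def by (metis sorted_list_of_set.idem_if_sorted_distinct)
  show "divisors_list N ! i = Suc i" "i < length (divisors_list N)"
    unfolding eq using assms(3) by (simp_all add: nth_append del: upt_Suc)
qed

text \<open>The first \<open>m\<close> divisors are \<open>1, ..., m\<close>, so the partial sums
  are \<open>N\<close> times harmonic numbers; as \<open>harm m\<close> exceeds
  \<open>ln (ln N)\<close>, the cutoff is decided within this range.\<close>

lemma first_cutoff_harm:
  assumes N: "N > 0" "\<And>n. 0 < n \<Longrightarrow> n \<le> m \<Longrightarrow> n dvd N"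
    and L: "1 \<le> ln (ln (real N))" "ln (ln (real N)) < harm m"
  shows "harm (first_cutoff N) \<le> ln (ln (real N))"
    and "ln (ln (real N)) < harm (Suc (first_cutoff N))"
proof -
  define S where "S = {divisors_list N ! j | j. j < length (divisors_list N) \<and>
     (\<Sum>i\<le>j. real N / real (divisors_list N ! i)) \<le> real N * ln (ln (real N))}"
  have sum: "(\<Sum>i\<le>j. real N / real (divisors_list N ! i)) = real N * harm (Suc j)" if "j < m" for j
  proof -
    have "(\<Sum>i\<le>j. real N / real (divisors_list N ! i)) = (\<Sum>i\<le>j. real N * inverse (real (Suc i)))"
      using that divisors_list_nth(1)[OF N] by (intro sum.cong) (auto simp: divide_inverse)
    also have "\<dots> = real N * harm (Suc j)"
      unfolding harm_altdef by (simp add: sum_distrib_left lessThan_Suc_atMost)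
    finally show ?thesis .
  qed
  have S: "S = {d. 0 < d \<and> d \<le> m \<and> harm d \<le> ln (ln (real N))}"
  proof (intro equalityI subsetI)
    fix d assume "d \<in> S"
    then obtain j where j: "d = divisors_list N ! j"
      "(\<Sum>i\<le>j. real N / real (divisors_list N ! i)) \<le> real N * ln (ln (real N))"
      by (auto simp: S_def)
    \<comment> \<open>Partial sums are monotone in \<open>j\<close>, so otherwise the index
      \<open>m - 1\<close> would be admissible too, against
      \<open>ln (ln N) < harm m\<close>.\<close>
    have "j < m"
    proof (rule ccontr)
      assume "\<not> j < m"
      have "m \<noteq> 0" using L by (intro notI) (simp add: harm_def)
      hence "real N * harm m = (\<Sum>i\<le>m - 1. real N / real (divisors_list N ! i))"
        using sum[of "m - 1"] by simp
      also have "\<dots> \<le> (\<Sum>i\<le>j. real N / real (divisors_list N ! i))"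
        using \<open>\<not> j < m\<close> by (intro sum_mono2) auto
      also note j(2)
      finally show False using L N(1) by simp
    qed
    thus "d \<in> {d. 0 < d \<and> d \<le> m \<and> harm d \<le> ln (ln (real N))}"
      using j sum[of j] divisors_list_nth(1)[OF N, of m j] N(1) by simp
  next
    fix d assume d: "d \<in> {d. 0 < d \<and> d \<le> m \<and> harm d \<le> ln (ln (real N))}"
    then obtain j where j: "d = Suc j" "j < m" by (cases d) auto
    show "d \<in> S" unfolding S_def
      using d j sum[of j] divisors_list_nth[OF N, of m j] N(1)
      by (auto intro!: exI[of _ j] mult_left_mono)
  qed
  have fin: "finite S" unfolding S by simp
  have "m \<noteq> 0" using L by (intro notI) (simp add: harm_def)
  hence "1 \<in> S" unfolding S using L by (simp add: harm_def)
  hence "first_cutoff N \<in> S"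
    unfolding first_cutoff_def S_def[symmetric] using fin by (intro Max_in) auto
  hence in_S: "first_cutoff N \<le> m" "harm (first_cutoff N) \<le> ln (ln (real N))"
    unfolding S by auto
  thus "harm (first_cutoff N) \<le> ln (ln (real N))" by simp
  show "ln (ln (real N)) < harm (Suc (first_cutoff N))"
  proof (cases "first_cutoff N = m")
    \<comment> \<open>This case is impossible: \<open>harm m\<close> would be both at most and above
      \<open>ln (ln N)\<close>.\<close>
    case True
    thus ?thesis using in_S L by simp
  next
    case False
    have "Suc (first_cutoff N) \<notin> S"
    proof
      assume "Suc (first_cutoff N) \<in> S"
      hence "Suc (first_cutoff N) \<le> Max S" using fin by (intro Max_ge)
      thus False by (simp add: first_cutoff_def S_def)
    qed
    thus ?thesis using False in_S by (simp add: S)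
  qed
qed

section \<open>The limit, by squeezing\<close>

theorem proposition9:
  "((\<lambda>N::nat. real (first_cutoff N) / ln (real N)) \<longlongrightarrow> exp (- (euler_mascheroni :: real)))
     (inf at_top (principal {N. superabundant N}))"
proof -
  define F where "F = inf (at_top :: nat filter) (principal {N. superabundant N})"
  \<comment> \<open>For \<open>n > 0\<close> this is \<open>n / exp (harm n)\<close>.\<close>
  define e where "e = (\<lambda>n. exp (ln (real n) - harm n))"
  have F_le: "F \<le> at_top" by (simp add: F_def)
  have e_lim: "e \<longlonglongrightarrow> exp (- euler_mascheroni)"
  proof -
    have "(\<lambda>n. exp (- (harm n - ln (real n)))) \<longlonglongrightarrow> exp (- euler_mascheroni)"
      by (intro tendsto_intros euler_mascheroni_LIMSEQ)
    thus ?thesis by (simp add: e_def)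
  qed
  \<comment> \<open>Since \<open>H_n - ln n > 19/33\<close> for large \<open>n\<close>, the factor
    \<open>7/10\<close> may be compensated by \<open>3/2\<close>: \<open>3/2 * 7/10 > 1\<close>
    absorbs the rounding, and \<open>ln (3/2) <= 1/2 < 19/33\<close>.\<close>
  have large: "eventually (\<lambda>N::nat. ln (ln (real N)) < harm (nat \<lfloor>7/10 * ln (real N)\<rfloor>)) at_top"
  proof -
    have lim: "filterlim (\<lambda>N::nat. nat \<lfloor>7/10 * ln (real N)\<rfloor>) at_top at_top"
      by real_asymp
    have "((\<lambda>n. harm n - ln (real n)) \<longlongrightarrow> euler_mascheroni) at_top" by (rule euler_mascheroni_LIMSEQ)
    hence "eventually (\<lambda>n. harm n - ln (real n) > 19/33) at_top"
      by (rule order_tendstoD) (rule euler_mascheroni_gt_19_over_33)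
    hence "eventually (\<lambda>N::nat. harm (nat \<lfloor>7/10 * ln (real N)\<rfloor>) -
        ln (real (nat \<lfloor>7/10 * ln (real N)\<rfloor>)) > 19/33) at_top"
      using lim by (rule eventually_compose_filterlim)
    moreover have "eventually (\<lambda>N::nat. ln (real N) < 3/2 * (7/10 * ln (real N) - 1)) at_top"
      by real_asymp
    moreover have "eventually (\<lambda>N::nat. 7/10 * ln (real N) - 1 > 0) at_top" by real_asymp
    ultimately show ?thesis
    proof eventually_elim
      case (elim N)
      have "ln (7/10 * ln (real N) - 1) \<le> ln (real (nat \<lfloor>7/10 * ln (real N)\<rfloor>))"
        using elim(3) by (intro ln_mono) linarith+
      moreover have "ln (ln (real N)) \<le> ln (3/2 * (7/10 * ln (real N) - 1))"
        using elim(2,3) by (intro ln_mono) linarith+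
      moreover have "\<dots> = ln (3/2) + ln (7/10 * ln (real N) - 1)"
        using elim(3) by (intro ln_mult_pos) auto
      moreover have "ln (3/2 :: real) \<le> 1/2" using ln_add_one_self_le_self[of "1/2 :: real"] by simp
      ultimately show ?case using elim(1) by linarith
    qed
  qed
  have "eventually (\<lambda>N::nat. 1 \<le> ln (ln (real N))) at_top"
    and "eventually (\<lambda>N::nat. ln (real N) > 0) at_top"
    and "eventually (\<lambda>N::nat. N > 0) at_top"
    by (real_asymp | rule eventually_gt_at_top)+
  hence "eventually (\<lambda>N::nat. 1 \<le> ln (ln (real N)) \<and> ln (real N) > 0 \<and> N > 0) at_top"
    by eventually_elim blast
  hence "eventually (\<lambda>N::nat. 1 \<le> ln (ln (real N)) \<and> ln (real N) > 0 \<and> N > 0) F"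
    using F_le by (rule filter_leD[rotated])
  moreover have "eventually (\<lambda>N::nat. ln (ln (real N)) < harm (nat \<lfloor>7/10 * ln (real N)\<rfloor>)) F"
    using F_le large by (rule filter_leD)
  ultimately have key: "eventually (\<lambda>N. ln (real N) > 0 \<and> harm (first_cutoff N) \<le> ln (ln (real N)) \<and>
      ln (ln (real N)) < harm (Suc (first_cutoff N))) F"
    using eventually_superabundant_dvd[folded F_def]
  proof eventually_elim
    case (elim N)
    have "n dvd N" if "0 < n" "n \<le> nat \<lfloor>7/10 * ln (real N)\<rfloor>" for n
    proof -
      have "real n \<le> 7/10 * ln (real N)" using that by linarith
      thus ?thesis using elim(3) that by blast
    qed
    thus ?case using elim first_cutoff_harm[of N "nat \<lfloor>7/10 * ln (real N)\<rfloor>"] by blast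
  qed
  have cutoff_lim: "filterlim first_cutoff at_top F"
  proof -
    have "filterlim (\<lambda>N::nat. ln (ln (real N)) - 1) at_top at_top" by real_asymp
    hence "filterlim (\<lambda>N::nat. ln (ln (real N)) - 1) at_top F"
      using F_le by (rule filterlim_mono[OF _ order_refl])
    moreover have "eventually (\<lambda>N. ln (ln (real N)) - 1 \<le> real (first_cutoff N)) F"
      using key
    proof eventually_elim
      case (elim N)
      \<comment> \<open>This crude bound suffices to turn
        \<open>ln (ln N) < harm (Suc (first_cutoff N))\<close> into divergence of the
        cutoff.\<close>
      have "harm n \<le> real n" for n
      proof (induction n)
        case (Suc n)
        have "inverse (real (Suc n)) \<le> 1" by (simp add: field_simps)
        thus ?case using Suc by (simp add: harm_Suc)
      qed (simp add: harm_def)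
      from this[of "Suc (first_cutoff N)"] show ?case using elim by simp
    qed
    ultimately have "filterlim (\<lambda>N. real (first_cutoff N)) at_top F"
      by (rule filterlim_at_top_mono)
    thus ?thesis by (simp add: filterlim_sequentially_iff_filterlim_real)
  qed
  have upper: "eventually (\<lambda>N. real (first_cutoff N) / ln (real N) \<le> e (first_cutoff N)) F"
    \<comment> \<open>The bound 1 excludes \<open>first_cutoff N = 0\<close>, where
      \<open>exp (ln n) = n\<close> fails.\<close>
    using key filterlim_at_top[THEN iffD1, OF cutoff_lim, rule_format, of 1]
  proof eventually_elim
    case (elim N)
    have "exp (harm (first_cutoff N)) \<le> ln (real N)"
      using elim by (metis exp_le_cancel_iff exp_ln)
    thus ?case using elim by (simp add: e_def exp_diff frac_le)
  qed
  \<comment> \<open>Maximality speaks of \<open>Suc (first_cutoff N)\<close>; returning to the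
    cutoff itself costs \<open>1 / ln N\<close>, which vanishes in the limit.\<close>
  have lower: "eventually (\<lambda>N. e (Suc (first_cutoff N)) - 1 / ln (real N)
      \<le> real (first_cutoff N) / ln (real N)) F"
    using key
  proof eventually_elim
    case (elim N)
    have "ln (real N) \<le> exp (harm (Suc (first_cutoff N)))"
      using elim by (metis exp_le_cancel_iff exp_ln less_imp_le)
    hence "e (Suc (first_cutoff N)) \<le> real (Suc (first_cutoff N)) / ln (real N)"
      using elim by (simp add: e_def exp_diff frac_le)
    thus ?case by (simp add: add_divide_distrib)
  qed
  have "((\<lambda>N. e (first_cutoff N)) \<longlongrightarrow> exp (- euler_mascheroni)) F"
    using e_lim cutoff_lim by (rule filterlim_compose)
  moreover have "((\<lambda>N. e (Suc (first_cutoff N)) - 1 / ln (real N)) \<longlongrightarrow> exp (- euler_mascheroni) - 0) F"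
  proof (rule tendsto_diff)
    have "((\<lambda>n. e (Suc n)) \<longlonglongrightarrow> exp (- euler_mascheroni))"
      using e_lim by (rule LIMSEQ_Suc)
    thus "((\<lambda>N. e (Suc (first_cutoff N))) \<longlongrightarrow> exp (- euler_mascheroni)) F"
      using cutoff_lim by (rule filterlim_compose)
    have "((\<lambda>N::nat. 1 / ln (real N)) \<longlonglongrightarrow> 0)" by real_asymp
    thus "((\<lambda>N::nat. 1 / ln (real N)) \<longlongrightarrow> 0) F" using F_le by (rule tendsto_mono[rotated])
  qed
  ultimately show ?thesis
    unfolding F_def[symmetric]
    using tendsto_sandwich[OF lower upper] by simp
qed

end
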